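(* Let $0<r<1$, $a>0$ and $t_k=\frac{k^r-1+a}{a}$ for $k\ge1$. Suppose that Assumption $A_1$ (local error bound condition) holds, let $(x_k)$ be generated by the Inertial Forward-Backward algorithm with this $(t_k)$, and let $x_*\in X$. Then, for any constant $p>1$, as $k\to\infty$: 1) $F(x_k)-F(x_* )=o\left(\frac{1}{k^p}\right)$ and $\|x_k-x_{k-1}\|=O\left(\frac{1}{k^p}\right)$. 2) $(x_k)$ converges (in norm) to some $\bar x\in X$, with rate $\|x_k-\bar x\|=O\left(\frac{1}{k^{p-1}}\right)$.
   Context: Setting. $H$ is a real Hilbert space; $f:H\to\mathbb{R}$ is convex and continuously differentiable with $L_f$-Lipschitz continuous gradient ($L_f>0$); $g:H\to\mathbb{R}\cup\{+\infty\}$ is proper, lower semicontinuous and convex; $F:=f+g$. It is assumed that $X:=\arg\min F\neq\emptyset$, and $F_*:=\min F=F(x_* )$ for $x_*\in X$. For $\lambda>0$, $\mathrm{prox}_{\lambda g}(z):=\arg\min_{x\in H}\{g(x)+\frac{1}{2\lambda}\|x-z\|^2\}$ and $T_\lambda(x):=\mathrm{prox}_{\lambda g}(x-\lambda\nabla f(x))$. Inertial Forward-Backward algorithm (IFB). Fix $\mu\in(0,1)$, $\lambda=\mu/L_f$, a starting point $x_0\in H$, $y_1=x_0$, and the sequence $(t_k)_{k\ge1}$ (with $t_1=1$). For $k\ge1$: $x_k=T_\lambda(y_k)$ and $y_{k+1}=x_k+\gamma_k(x_k-x_{k-1})$, where $\gamma_k=\frac{t_k-1}{t_{k+1}}$.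 Assumption $A_1$ (local error bound condition): for any $\xi\ge F_*$ there exist $\varepsilon>0$ and $\bar\tau>0$ such that $\mathrm{dist}(x,X)\le\bar\tau\,\|T_{1/L_f}(x)-x\|$ whenever $\|T_{1/L_f}(x)-x\|<\varepsilon$ and $F(x)\le\xi$. *)

theory Defs
  imports "HOL-Analysis.Analysis" "HOL-Library.Landau_Symbols"
begin

definition proper_fun :: "('a \<Rightarrow> ereal) \<Rightarrow> bool" where
  "proper_fun g \<longleftrightarrow> (\<forall>x. g x \<noteq> -\<infinity>) \<and> (\<exists>x. g x \<noteq> \<infinity>)"

definition lsc_fun :: "('a::topological_space \<Rightarrow> ereal) \<Rightarrow> bool" where
  "lsc_fun g \<longleftrightarrow> (\<forall>x. g x \<le> Liminf (at x) g)"

(* Meant for functions that never take the value -\<infinity>, so that the sum on the right is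
   unambiguous; at u = 0 the convention 0 * \<infinity> = 0 makes the inequality trivial. *)
definition convex_fun :: "('a::real_vector \<Rightarrow> ereal) \<Rightarrow> bool" where
  "convex_fun g \<longleftrightarrow> (\<forall>x y. \<forall>u::real. 0 \<le> u \<longrightarrow> u \<le> 1 \<longrightarrow>
     g (u *\<^sub>R x + (1 - u) *\<^sub>R y) \<le> ereal u * g x + ereal (1 - u) * g y)"

definition objective :: "('a \<Rightarrow> real) \<Rightarrow> ('a \<Rightarrow> ereal) \<Rightarrow> 'a \<Rightarrow> ereal" where
  "objective f g x = ereal (f x) + g x"

definition argmin_set :: "('a \<Rightarrow> ereal) \<Rightarrow> 'a set" where
  "argmin_set F = {x. is_arg_min F (\<lambda>_. True) x}"

(* For g proper, lower semicontinuous and convex on a Hilbert space and \<lambda> > 0 the minimiser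
   exists and is unique, so the choice made by arg_min is immaterial. *)
definition prox :: "real \<Rightarrow> ('a::real_normed_vector \<Rightarrow> ereal) \<Rightarrow> 'a \<Rightarrow> 'a" where
  "prox l g z = arg_min (\<lambda>x. g x + ereal (1 / (2 * l) * (norm (x - z))\<^sup>2)) (\<lambda>_. True)"

(* gradf stands for the gradient of f. *)
definition fb_step ::
  "('a \<Rightarrow> 'a) \<Rightarrow> ('a::real_normed_vector \<Rightarrow> ereal) \<Rightarrow> real \<Rightarrow> 'a \<Rightarrow> 'a" where
  "fb_step gradf g l x = prox l g (x - l *\<^sub>R gradf x)"

(* \<xi> ranges over the reals: for \<xi> = \<infinity> the condition would be a global, stronger one. *)
definition local_error_bound ::
  "('a::real_normed_vector \<Rightarrow> real) \<Rightarrow> ('a \<Rightarrow> 'a) \<Rightarrow> ('a \<Rightarrow> ereal) \<Rightarrow> real \<Rightarrow> bool" where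
  "local_error_bound f gradf g L \<longleftrightarrow>
     (\<forall>\<xi>::real. (INF x. objective f g x) \<le> ereal \<xi> \<longrightarrow>
        (\<exists>\<epsilon>>0. \<exists>\<tau>>0. \<forall>x.
           norm (fb_step gradf g (1 / L) x - x) < \<epsilon> \<and> objective f g x \<le> ereal \<xi> \<longrightarrow>
           infdist x (argmin_set (objective f g)) \<le> \<tau> * norm (fb_step gradf g (1 / L) x - x)))"

(* The auxiliary sequence y starts at index 1; the value y 0 is not used. *)
definition ifb_sequence ::
  "('a \<Rightarrow> 'a) \<Rightarrow> ('a::real_normed_vector \<Rightarrow> ereal) \<Rightarrow> real \<Rightarrow> (nat \<Rightarrow> real) \<Rightarrow>
     (nat \<Rightarrow> 'a) \<Rightarrow> (nat \<Rightarrow> 'a) \<Rightarrow> bool" where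
  "ifb_sequence gradf g l t x y \<longleftrightarrow>
     y 1 = x 0 \<and>
     (\<forall>k\<ge>1. x k = fb_step gradf g l (y k) \<and>
        y (k + 1) = x k + ((t k - 1) / t (k + 1)) *\<^sub>R (x k - x (k - 1)))"

end

theory Submission
  imports Defs "HOL-Real_Asymp.Real_Asymp"
begin

text \<open>
  Put \<open>v\<^sub>k = F(x\<^sub>k) - F\<^sub>*\<close> and \<open>\<delta>\<^sub>k = \<parallel>x\<^sub>k - x\<^sub>k\<^sub>-\<^sub>1\<parallel>\<^sup>2 / (2\<lambda>)\<close>. The forward-backward step at \<open>y\<^sub>k\<^sub>+\<^sub>1\<close>,
  compared with the point \<open>x\<^sub>k\<close>, yields
  \<open>v\<^sub>k\<^sub>+\<^sub>1 + \<delta>\<^sub>k\<^sub>+\<^sub>1 + (1 - \<mu>)/(2\<lambda>) \<parallel>x\<^sub>k\<^sub>+\<^sub>1 - y\<^sub>k\<^sub>+\<^sub>1\<parallel>\<^sup>2 \<le> v\<^sub>k + \<gamma>\<^sub>k\<^sup>2 \<delta>\<^sub>k\<close>.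
  Hence \<open>v + \<delta>\<close> decreases and \<open>x\<^sub>k - y\<^sub>k\<close> tends to 0. The residual at \<open>x\<^sub>k\<close> is bounded by a multiple of
  \<open>\<parallel>x\<^sub>k - y\<^sub>k\<parallel>\<close>, so the error bound, applied after comparing with points of \<open>X\<close> close to \<open>x\<^sub>k\<close>, gives
  \<open>v\<^sub>k \<le> C \<parallel>x\<^sub>k - y\<^sub>k\<parallel>\<^sup>2\<close> eventually. Since \<open>1 - \<gamma>\<^sub>k\<close> is at least of order \<open>k\<^sup>-\<^sup>r\<close>, the energy
  \<open>w = (1 + b) v + \<delta>\<close> with \<open>b = (1 - \<mu>)/(2\<lambda>C)\<close> contracts: \<open>w\<^sub>k\<^sub>+\<^sub>1 \<le> (1 - c k\<^sup>-\<^sup>r) w\<^sub>k\<close>. As \<open>r < 1\<close>, it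
  decays faster than every power of \<open>k\<close>; the rates and the summability of the steps follow.
\<close>

section \<open>Smooth convex functions\<close>

text \<open>Convexity along a segment, divided by the parameter \<open>u\<close>, leaves an error of
  order \<open>u\<close>; letting \<open>u\<close> tend to 0 from the right removes it.\<close>

lemma le_if_le_add_small_mult:
  fixes A B C :: real
  assumes "\<And>u. 0 < u \<Longrightarrow> u \<le> 1 \<Longrightarrow> A \<le> B + u * C"
  shows "A \<le> B"
proof (rule tendsto_lowerbound)
  show "((\<lambda>u. B + u * C) \<longlongrightarrow> B) (at_right 0)"
    by (auto intro!: tendsto_eq_intros)
  show "\<forall>\<^sub>F u in at_right 0. A \<le> B + u * C"
    unfolding eventually_at_right_field
    by (rule exI[of _ 1]) (auto intro: assms)
qed simp

text \<open>The descent lemma. On the segment from \<open>z\<close> to \<open>w\<close>, the excess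
  of \<open>f\<close> over the quadratic model has derivative at most 0, by Cauchy-Schwarz and the
  Lipschitz bound.\<close>

lemma lipschitz_gradient_upper_bound:
  fixes f :: "'a::real_inner \<Rightarrow> real"
  assumes df: "\<And>z. GDERIV f z :> gradf z" and lip: "L-lipschitz_on UNIV gradf"
  shows "f w \<le> f z + inner (gradf z) (w - z) + L / 2 * (norm (w - z))\<^sup>2"
proof -
  define \<phi> where "\<phi> t = f (z + t *\<^sub>R (w - z)) - t * inner (gradf z) (w - z)
    - L / 2 * t\<^sup>2 * (norm (w - z))\<^sup>2" for t
  define \<phi>' where "\<phi>' t = inner (gradf (z + t *\<^sub>R (w - z)) - gradf z) (w - z)
    - L * t * (norm (w - z))\<^sup>2" for t
  have "\<phi> 1 \<le> \<phi> 0"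
  proof (rule DERIV_nonpos_imp_nonincreasing[of 0 1 \<phi>])
    fix t :: real assume t: "0 \<le> t" "t \<le> 1"
    have line: "((\<lambda>t. z + t *\<^sub>R (w - z)) has_derivative (\<lambda>h. h *\<^sub>R (w - z))) (at t)"
      by (auto intro!: derivative_eq_intros)
    have "((\<lambda>t. f (z + t *\<^sub>R (w - z))) has_derivative
        (\<lambda>h. inner (h *\<^sub>R (w - z)) (gradf (z + t *\<^sub>R (w - z))))) (at t)"
      by (rule has_derivative_compose[OF line]) (use df in \<open>simp add: gderiv_def\<close>)
    then have "((\<lambda>t. f (z + t *\<^sub>R (w - z))) has_real_derivative
        inner (gradf (z + t *\<^sub>R (w - z))) (w - z)) (at t)"
      unfolding has_field_derivative_def
      by (rule has_derivative_eq_rhs) (simp add: fun_eq_iff inner_commute)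
    then have "(\<phi> has_real_derivative \<phi>' t) (at t)"
      unfolding \<phi>_def \<phi>'_def
      by (auto intro!: derivative_eq_intros simp: inner_diff_left)
    moreover have "\<phi>' t \<le> 0"
    proof -
      have "inner (gradf (z + t *\<^sub>R (w - z)) - gradf z) (w - z)
          \<le> norm (gradf (z + t *\<^sub>R (w - z)) - gradf z) * norm (w - z)"
        by (rule norm_cauchy_schwarz)
      also have "\<dots> \<le> (L * norm (t *\<^sub>R (w - z))) * norm (w - z)"
        using lipschitz_onD[OF lip, of "z + t *\<^sub>R (w - z)" z]
        by (intro mult_right_mono) (auto simp: dist_norm)
      finally show ?thesis
        using t by (simp add: \<phi>'_def power2_eq_square mult_ac)
    qed
    ultimately show "\<exists>y. (\<phi> has_real_derivative y) (at t) \<and> y \<le> 0" by blast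
  qed simp
  then show ?thesis by (simp add: \<phi>_def)
qed

lemma lipschitz_gradient_lower_bound:
  fixes f :: "'a::real_inner \<Rightarrow> real"
  assumes df: "\<And>z. GDERIV f z :> gradf z" and lip: "L-lipschitz_on UNIV gradf"
  shows "f z + inner (gradf z) (w - z) - L / 2 * (norm (w - z))\<^sup>2 \<le> f w"
proof -
  have "GDERIV (\<lambda>z. - f z) z :> - gradf z" for z
    using df by (rule GDERIV_minus)
  moreover have "L-lipschitz_on UNIV (\<lambda>z. - gradf z)"
    using lip by simp
  ultimately show ?thesis
    using lipschitz_gradient_upper_bound[of "\<lambda>z. - f z" "\<lambda>z. - gradf z" L w z] by simp
qed

text \<open>At the point \<open>v\<close> of the segment, the quadratic lower bound is compared with
  the chord. Both gaps are linear in \<open>u\<close> up to an error of order \<open>u\<close>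
  squared, so division by \<open>u\<close> leaves the tangent inequality in the limit.\<close>

lemma convex_above_tangent:
  fixes f :: "'a::real_inner \<Rightarrow> real"
  assumes conv: "convex_on UNIV f"
    and df: "\<And>z. GDERIV f z :> gradf z" and lip: "L-lipschitz_on UNIV gradf"
  shows "f z + inner (gradf z) (w - z) \<le> f w"
proof (rule le_if_le_add_small_mult)
  fix u :: real assume u: "0 < u" "u \<le> 1"
  define v where "v = (1 - u) *\<^sub>R z + u *\<^sub>R w"
  have v: "v - z = u *\<^sub>R (w - z)" by (simp add: v_def algebra_simps)
  have "f z + inner (gradf z) (v - z) - L / 2 * (norm (v - z))\<^sup>2 \<le> f v"
    by (rule lipschitz_gradient_lower_bound[OF df lip])
  also have "f v \<le> (1 - u) * f z + u * f w"
    unfolding v_def using u conv by (intro convex_onD) auto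
  finally have "f z + u * inner (gradf z) (w - z) - L / 2 * (u\<^sup>2 * (norm (w - z))\<^sup>2)
      \<le> (1 - u) * f z + u * f w"
    by (simp only: v inner_scaleR_right norm_scaleR power_mult_distrib power2_abs)
  then have "u * (f z + inner (gradf z) (w - z))
      \<le> u * (f w + u * (L / 2 * (norm (w - z))\<^sup>2))"
    by (simp add: power2_eq_square ring_distribs mult_ac)
  then show "f z + inner (gradf z) (w - z) \<le> f w + u * (L / 2 * (norm (w - z))\<^sup>2)"
    using u by simp
qed

section \<open>Optimality and the proximal map\<close>

text \<open>Lower semicontinuity in sequential form: a value of \<open>g\<close> at the limit above
  \<open>c\<close> would leave room for a real \<open>s\<close> that separates \<open>b n\<close>
  from \<open>g (u n)\<close>.\<close>

lemma lsc_fun_tendsto_le: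
  fixes g :: "'a::topological_space \<Rightarrow> ereal"
  assumes lsc: "lsc_fun g" and lim: "u \<longlonglongrightarrow> q" "b \<longlonglongrightarrow> c"
    and le: "\<forall>\<^sub>F n in sequentially. g (u n) \<le> ereal (b n)"
  shows "g q \<le> ereal c"
proof (rule ccontr)
  assume "\<not> g q \<le> ereal c"
  then have "ereal c < g q" by simp
  then obtain e where e: "ereal c < e" "e < g q" using dense by blast
  then obtain s where s: "ereal c < ereal s" "ereal s < e" using ereal_dense2 by blast
  have sq: "ereal s < g q" using s e by order
  have "\<forall>\<^sub>F z in at q. ereal s < g z"
    using lsc sq unfolding lsc_fun_def le_Liminf_iff by blast
  \<comment> \<open>\<open>Liminf (at q)\<close> ignores \<open>q\<close> itself, but
    \<open>u n\<close> may equal \<open>q\<close>; the inequality at \<open>q\<close> extends the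
    punctured neighbourhood to a full one.\<close>
  then have "\<forall>\<^sub>F z in nhds q. ereal s < g z"
    using sq by (auto simp: eventually_at_filter elim!: eventually_mono)
  then have "\<forall>\<^sub>F n in sequentially. ereal s < g (u n)"
    using lim(1) by (rule eventually_compose_filterlim)
  moreover have "\<forall>\<^sub>F n in sequentially. b n < s"
    using lim(2) s by (auto intro: order_tendstoD(2))
  ultimately have "\<forall>\<^sub>F n in sequentially. False"
    using le
  proof eventually_elim
    case (elim n)
    from elim(1,3) have "ereal s < ereal (b n)" by (rule order.strict_trans2)
    with elim(2) show ?case by simp
  qed
  then show False by simp
qed

lemma is_arg_min_finite:
  fixes g :: "'a \<Rightarrow> ereal" and q :: "'a \<Rightarrow> real"
  assumes "proper_fun g" "is_arg_min (\<lambda>x. ereal (q x) + g x) (\<lambda>_. True) w"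
  shows "\<bar>g w\<bar> \<noteq> \<infinity>"
proof -
  obtain z where z: "g z \<noteq> \<infinity>" and "g w \<noteq> -\<infinity>"
    using assms(1) by (auto simp: proper_fun_def)
  moreover have "ereal (q w) + g w \<le> ereal (q z) + g z"
    using assms(2) by (auto simp: is_arg_min_linorder)
  ultimately show ?thesis by auto
qed

text \<open>First-order optimality: only a quadratic upper bound of the smooth part at the minimiser is
  needed, which covers both the objective and the proximal subproblem.\<close>
lemma is_arg_min_subgradient:
  fixes g :: "'a::real_inner \<Rightarrow> ereal" and q :: "'a \<Rightarrow> real"
  assumes g: "proper_fun g" "convex_fun g"
    and argmin: "is_arg_min (\<lambda>x. ereal (q x) + g x) (\<lambda>_. True) w"
    and quad: "\<And>x. q x \<le> q w + inner d (x - w) + C * (norm (x - w))\<^sup>2"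
    and fin: "g x \<noteq> \<infinity>"
  shows "real_of_ereal (g w) - inner d (x - w) \<le> real_of_ereal (g x)"
proof (rule le_if_le_add_small_mult)
  fix u :: real assume u: "0 < u" "u \<le> 1"
  define v where "v = u *\<^sub>R x + (1 - u) *\<^sub>R w"
  have v: "v - w = u *\<^sub>R (x - w)" by (simp add: v_def algebra_simps)
  have "\<bar>g w\<bar> \<noteq> \<infinity>" using is_arg_min_finite[OF g(1) argmin] .
  then obtain gw where gw: "g w = ereal gw" by auto
  obtain gx where gx: "g x = ereal gx"
    using fin g(1) by (cases "g x") (auto simp: proper_fun_def)
  have "ereal (q w) + g w \<le> ereal (q v) + g v"
    using argmin by (auto simp: is_arg_min_linorder)
  also have "g v \<le> ereal u * g x + ereal (1 - u) * g w"
    using g(2) u unfolding convex_fun_def v_def by force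
  finally have "q w + gw \<le> q v + (u * gx + (1 - u) * gw)"
    by (simp add: gw gx add_left_mono)
  also have "q v \<le> q w + inner d (v - w) + C * (norm (v - w))\<^sup>2" by (rule quad)
  finally have "gw \<le> u * inner d (x - w) + C * (u\<^sup>2 * (norm (x - w))\<^sup>2) + (u * gx + (1 - u) * gw)"
    by (simp only: v inner_scaleR_right norm_scaleR power_mult_distrib power2_abs) simp
  then have "u * (gw - inner d (x - w)) \<le> u * (gx + u * (C * (norm (x - w))\<^sup>2))"
    by (simp add: power2_eq_square ring_distribs mult_ac)
  then have "gw - inner d (x - w) \<le> gx + u * (C * (norm (x - w))\<^sup>2)"
    using u by simp
  then show "real_of_ereal (g w) - inner d (x - w)
      \<le> real_of_ereal (g x) + u * (C * (norm (x - w))\<^sup>2)"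
    by (simp add: gw gx)
qed

text \<open>Existence by the direct method: the affine minorant bounds the functional from below,
  strong convexity makes a minimising sequence Cauchy, and lower semicontinuity makes its limit a
  minimiser. The smooth term stands first to match \<open>is_arg_min_subgradient\<close>.\<close>

lemma prox_is_arg_min:
  fixes g :: "'a::{real_inner,complete_space} \<Rightarrow> ereal"
  assumes g: "proper_fun g" "lsc_fun g" "convex_fun g"
    and minor: "\<And>x. ereal (c + inner d x) \<le> g x" and l: "l > 0"
  shows "is_arg_min (\<lambda>x. ereal (1 / (2 * l) * (norm (x - z))\<^sup>2) + g x) (\<lambda>_. True) (prox l g z)"
proof -
  define q where "q x = 1 / (2 * l) * (norm (x - z))\<^sup>2" for x
  define G where "G x = real_of_ereal (g x)" for x
  define D where "D = {x. g x \<noteq> \<infinity>}"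
  have gG: "g x = ereal (G x)" if "x \<in> D" for x
    using that g(1) unfolding D_def G_def proper_fun_def by (cases "g x") auto
  define h where "h x = q x + G x" for x
  obtain x0 where x0: "x0 \<in> D" using g(1) by (auto simp: proper_fun_def D_def)
  \<comment> \<open>The left side is the minimum of the affine minorant plus the quadratic, found by
    completing the square.\<close>
  have "c + inner d z - l / 2 * (norm d)\<^sup>2 \<le> h x" if "x \<in> D" for x
  proof -
    have "0 \<le> 1 / (2 * l) * (norm (x - z + l *\<^sub>R d))\<^sup>2" using l by simp
    also have "\<dots> = q x + inner d (x - z) + l / 2 * (norm d)\<^sup>2"
      using l unfolding q_def power2_norm_eq_inner
      by (simp add: inner_simps inner_commute field_simps)
    finally show ?thesis
      using minor[of x] gG[OF that] by (simp add: h_def inner_diff_right)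
  qed
  then have bdd: "bdd_below (h ` D)" by (auto intro!: bdd_belowI2)
  define m where "m = (INF x\<in>D. h x)"
  have m_le: "m \<le> h x" if "x \<in> D" for x
    unfolding m_def using bdd that by (rule cINF_lower)
  have "\<exists>x\<in>D. h x < m + e" if "e > 0" for e
    using cINF_less_iff[of D h "m + e"] bdd x0 that unfolding m_def by auto
  then have "\<exists>x\<in>D. h x < m + inverse (real (Suc n))" for n by simp
  then obtain u where u: "\<And>n. u n \<in> D" "\<And>n. h (u n) < m + inverse (real (Suc n))"
    by metis
  \<comment> \<open>The parallelogram identity at the midpoint \<open>s\<close>: two points with
    values near \<open>m\<close> are close to each other.\<close>
  have mid: "(norm (v - w))\<^sup>2 \<le> 4 * l * (h v + h w - 2 * m)" if "v \<in> D" "w \<in> D" for v w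
  proof -
    define s where "s = (1/2) *\<^sub>R v + (1 - 1/2) *\<^sub>R w"
    have gs: "g s \<le> ereal (1/2) * g v + ereal (1 - 1/2) * g w"
      using g(3)[unfolded convex_fun_def, rule_format, of "1/2" v w] by (simp add: s_def)
    then have gs': "g s \<le> ereal ((G v + G w) / 2)"
      using gG[OF that(1)] gG[OF that(2)] by (simp add: field_simps)
    then have s: "s \<in> D" by (auto simp: D_def)
    have "m \<le> h s" using s by (rule m_le)
    also have "\<dots> \<le> q s + (G v + G w) / 2"
      using gs' gG[OF s] by (simp add: h_def)
    also have "q s = (q v + q w) / 2 - 1 / (8 * l) * (norm (v - w))\<^sup>2"
      using l unfolding q_def s_def power2_norm_eq_inner
      by (simp add: inner_simps inner_commute field_simps)
    finally have "1 / (8 * l) * (norm (v - w))\<^sup>2 \<le> (h v + h w - 2 * m) / 2"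
      by (simp add: h_def field_simps)
    then show ?thesis using l by (simp add: field_simps)
  qed
  have "Cauchy u"
  proof (rule metric_CauchyI)
    fix e :: real assume e: "e > 0"
    obtain N where N: "inverse (real (Suc N)) < e\<^sup>2 / (8 * l)"
      using reals_Archimedean[of "e\<^sup>2 / (8 * l)"] e l by auto
    have "dist (u i) (u j) < e" if ij: "i \<ge> N" "j \<ge> N" for i j
    proof -
      have small: "h (u n) - m < e\<^sup>2 / (8 * l)" if "n \<ge> N" for n
      proof -
        have "inverse (real (Suc n)) \<le> inverse (real (Suc N))" using that by simp
        then show ?thesis using u(2)[of n] N by linarith
      qed
      have "(norm (u i - u j))\<^sup>2 \<le> 4 * l * (h (u i) + h (u j) - 2 * m)"
        by (rule mid) (rule u)+
      also have "\<dots> < 4 * l * (e\<^sup>2 / (8 * l) + e\<^sup>2 / (8 * l))"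
        using small[OF ij(1)] small[OF ij(2)] l by (intro mult_strict_left_mono) auto
      also have "\<dots> = e\<^sup>2" using l by simp
      finally show ?thesis using e by (simp add: dist_norm power2_less_imp_less)
    qed
    then show "\<exists>M. \<forall>m\<ge>M. \<forall>n\<ge>M. dist (u m) (u n) < e" by blast
  qed
  then obtain w where w: "u \<longlonglongrightarrow> w" using Cauchy_convergent convergent_def by blast
  have "(\<lambda>n. m + inverse (real (Suc n)) - q (u n)) \<longlonglongrightarrow> m + 0 - q w"
    unfolding q_def by (intro tendsto_intros w LIMSEQ_inverse_real_of_nat)
  moreover have "g (u n) \<le> ereal (m + inverse (real (Suc n)) - q (u n))" for n
    using u(2)[of n] gG[OF u(1)[of n]] by (simp add: h_def)
  ultimately have gw: "g w \<le> ereal (m - q w)"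
    using lsc_fun_tendsto_le[OF g(2) w] by simp
  have "is_arg_min (\<lambda>x. g x + ereal (q x)) (\<lambda>_. True) w"
    unfolding is_arg_min_linorder
  proof (intro conjI allI impI TrueI)
    fix x
    show "g w + ereal (q w) \<le> g x + ereal (q x)"
    proof (cases "x \<in> D")
      case True
      have "g w + ereal (q w) \<le> ereal (m - q w) + ereal (q w)"
        by (intro add_right_mono gw)
      also have "\<dots> \<le> g x + ereal (q x)"
        using m_le[OF True] gG[OF True] by (simp add: h_def)
      finally show ?thesis .
    qed (simp add: D_def)
  qed
  \<comment> \<open>\<open>arg_min\<close> is a choice among minimisers, so the existence of one
    suffices.\<close>
  then have "is_arg_min (\<lambda>x. g x + ereal (q x)) (\<lambda>_. True) (prox l g z)"
    unfolding prox_def arg_min_def q_def by (rule someI)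
  then show ?thesis by (simp add: q_def add.commute)
qed

section \<open>Sequences\<close>

text \<open>One step multiplies \<open>w k\<close> by at most \<open>exp (- c / k powr r)\<close>
  and \<open>k powr q\<close> by at most \<open>exp (q / k)\<close>. As \<open>r < 1\<close>, the
  first factor wins eventually, so \<open>w k * k powr q\<close> becomes nonincreasing.\<close>

lemma superpolynomial_decay:
  fixes w :: "nat \<Rightarrow> real"
  assumes nonneg: "\<And>k. 0 \<le> w k" and r: "r < 1" and c: "c > 0" and q: "q \<ge> 0"
    and step: "\<forall>\<^sub>F k in sequentially. w (Suc k) \<le> (1 - c / real k powr r) * w k"
  shows "\<exists>C>0. \<forall>\<^sub>F k in sequentially. w k \<le> C / real k powr q"
proof -
  have "filterlim (\<lambda>k. real k powr (1 - r)) at_top sequentially"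
    using r by real_asymp
  then have "\<forall>\<^sub>F k in sequentially. q / c \<le> real k powr (1 - r)"
    by (simp add: filterlim_at_top)
  then have "\<forall>\<^sub>F k in sequentially. k > 0 \<and> q / c \<le> real k powr (1 - r) \<and>
      w (Suc k) \<le> (1 - c / real k powr r) * w k"
    using step eventually_gt_at_top[of 0] by eventually_elim auto
  then obtain N where N: "\<And>k. k \<ge> N \<Longrightarrow> k > 0 \<and> q / c \<le> real k powr (1 - r) \<and>
      w (Suc k) \<le> (1 - c / real k powr r) * w k"
    by (auto simp: eventually_sequentially)
  have decr: "w (Suc k) * real (Suc k) powr q \<le> w k * real k powr q" if "k \<ge> N" for k
  proof -
    have k: "k > 0" "q / c \<le> real k powr (1 - r)"
      "w (Suc k) \<le> (1 - c / real k powr r) * w k" using N[OF that] by auto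
    have "real (Suc k) = (1 + 1 / real k) * real k" using k by (simp add: field_simps)
    also have "\<dots> powr q = (1 + 1 / real k) powr q * real k powr q"
      using k by (intro powr_mult)
    also have "(1 + 1 / real k) powr q \<le> exp (1 / real k) powr q"
      using q by (intro powr_mono2) (auto simp: exp_ge_add_one_self)
    also have "exp (1 / real k) powr q = exp (q / real k)"
      by (simp add: powr_def)
    finally have A: "real (Suc k) powr q \<le> exp (q / real k) * real k powr q"
      by (simp add: mult_right_mono)
    have "w (Suc k) \<le> exp (- (c / real k powr r)) * w k"
      using k(3) mult_right_mono[OF exp_ge_add_one_self[of "- (c / real k powr r)"] nonneg[of k]]
      by simp
    then have "w (Suc k) * real (Suc k) powr q
        \<le> (exp (- (c / real k powr r)) * w k) * (exp (q / real k) * real k powr q)"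
      using A nonneg by (intro mult_mono) auto
    also have "\<dots> = exp (q / real k - c / real k powr r) * (w k * real k powr q)"
      by (simp add: exp_diff exp_minus field_simps)
    also have "\<dots> \<le> 1 * (w k * real k powr q)"
    proof (intro mult_right_mono)
      have "real k powr (1 - r) = real k / real k powr r"
        using k by (simp add: powr_diff)
      then have "q / c \<le> real k / real k powr r"
        using k(2) by simp
      then have "q / real k \<le> c / real k powr r"
        using k(1) c by (simp add: field_simps)
      then show "exp (q / real k - c / real k powr r) \<le> 1" by simp
    qed (use nonneg in auto)
    finally show ?thesis by simp
  qed
  \<comment> \<open>The added 1 keeps \<open>C\<close> positive even if
    \<open>w N = 0\<close>.\<close>
  define C where "C = w N * real N powr q + 1"
  have "w k * real k powr q \<le> C" if "k \<ge> N" for k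
    using that
  proof (induction k rule: dec_induct)
    case (step k) then show ?case using decr[of k] by simp
  qed (simp add: C_def)
  then have "w k \<le> C / real k powr q" if "k \<ge> N" for k
    using that N[OF that] by (simp add: field_simps)
  moreover have "C > 0" using nonneg[of N] by (simp add: C_def add_nonneg_pos)
  ultimately show ?thesis by (auto simp: eventually_sequentially)
qed

text \<open>The sort intersection below does not entail the class banach, so the library's summability
  tests do not apply and the Cauchy property is shown directly.\<close>
lemma convergent_rate_of_steps:
  fixes x :: "nat \<Rightarrow> 'a::{real_normed_vector,complete_space}"
  assumes q: "q > 0" and C: "C \<ge> 0"
    and step: "\<forall>\<^sub>F k in sequentially. norm (x (Suc k) - x k) \<le> C / real (Suc k) powr (q + 2)"
  shows "\<exists>l. x \<longlonglongrightarrow> l \<and> (\<lambda>k. norm (x k - l)) \<in> O(\<lambda>k. 1 / real k powr q)"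
proof -
  \<comment> \<open>Two of the \<open>q + 2\<close> powers make the series summable; the other
    \<open>q\<close> are frozen at the first index of the tail and give the rate.\<close>
  define a where "a k = C / real (Suc k) ^ 2" for k
  have summ: "summable a"
    unfolding a_def using inverse_power_summable[of 2]
    by (subst summable_Suc_iff[of "\<lambda>k. C / real k ^ 2"])
       (auto simp: divide_inverse power_inverse intro!: summable_mult)
  obtain N where N: "N > 0"
      "\<And>k. k \<ge> N \<Longrightarrow> norm (x (Suc k) - x k) \<le> C / real (Suc k) powr (q + 2)"
    using eventually_conj[OF step eventually_gt_at_top[of 0]]
    unfolding eventually_sequentially by blast
  have stepa: "norm (x (Suc j) - x j) \<le> a j / real k powr q" if "k \<ge> N" "j \<ge> k" for j k
  proof -
    have "norm (x (Suc j) - x j) \<le> C / (real (Suc j) powr q * real (Suc j) ^ 2)"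
      using N(2)[of j] that by (simp add: powr_add powr_numeral)
    also have "\<dots> \<le> C / (real k powr q * real (Suc j) ^ 2)"
      using that N(1) q C by (intro divide_left_mono mult_right_mono powr_mono2) auto
    finally show ?thesis by (simp add: a_def field_simps)
  qed
  have a0: "0 \<le> a k" for k using C by (simp add: a_def)
  have bound: "norm (x m - x k) \<le> suminf a / real k powr q" if "k \<ge> N" "m \<ge> k" for k m
  proof -
    have "x m - x k = (\<Sum>j=k..<m. x (Suc j) - x j)" using that by (simp add: sum_Suc_diff')
    then have "norm (x m - x k) \<le> (\<Sum>j=k..<m. a j / real k powr q)"
      using stepa[OF that(1)] by (auto intro!: sum_norm_le)
    also have "\<dots> = (\<Sum>j=k..<m. a j) / real k powr q" by (simp add: sum_divide_distrib)
    also have "\<dots> \<le> suminf a / real k powr q"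
      using summ a0 by (intro divide_right_mono sum_le_suminf) auto
    finally show ?thesis .
  qed
  have "Cauchy x"
  proof (rule CauchyI')
    fix e :: real assume e: "e > 0"
    have "(\<lambda>k. 1 / real k powr q) \<longlonglongrightarrow> 0"
      using q by real_asymp
    from tendsto_mult_right[OF this, of "suminf a"]
    have "(\<lambda>k. suminf a / real k powr q) \<longlonglongrightarrow> 0" by simp
    then have "\<forall>\<^sub>F k in sequentially. suminf a / real k powr q < e"
      using e by (rule order_tendstoD)
    then obtain M where M: "\<And>k. k \<ge> M \<Longrightarrow> suminf a / real k powr q < e"
      by (auto simp: eventually_sequentially)
    have "dist (x k) (x m) < e" if "max M N \<le> k" "k < m" for k m
      using bound[of k m] M[of k] that by (simp add: dist_norm norm_minus_commute)
    then show "\<exists>M. \<forall>k\<ge>M. \<forall>m>k. dist (x k) (x m) < e" by blast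
  qed
  then have "convergent x" by (rule Cauchy_convergent)
  then obtain l where l: "x \<longlonglongrightarrow> l" by (auto simp: convergent_def)
  have "norm (x k - l) \<le> suminf a * norm (1 / real k powr q)" if "k \<ge> N" for k
  proof -
    have "(\<lambda>m. norm (x m - x k)) \<longlonglongrightarrow> norm (l - x k)" by (intro tendsto_intros l)
    moreover have "\<forall>\<^sub>F m in sequentially. norm (x m - x k) \<le> suminf a / real k powr q"
      using bound[OF that] by (auto simp: eventually_sequentially)
    ultimately have "norm (l - x k) \<le> suminf a / real k powr q"
      by (rule tendsto_upperbound) simp
    then show ?thesis by (simp add: norm_minus_commute)
  qed
  then have "(\<lambda>k. norm (x k - l)) \<in> O(\<lambda>k. 1 / real k powr q)"
    by (intro bigoI[of _ "suminf a"]) (auto simp: eventually_sequentially)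
  with l show ?thesis by blast
qed

text \<open>The numerical core: \<open>v\<close> is the value gap, \<open>\<delta>\<close> the
  kinetic term, \<open>s\<close> the residual and \<open>\<theta>\<close> the squared inertia.
  Monotone energy drives \<open>s\<close> to 0, so \<open>growth\<close> applies eventually and the
  dissipated term controls \<open>v\<close>.\<close>

lemma inertial_energy_decay:
  fixes v \<delta> s \<theta> :: "nat \<Rightarrow> real"
  assumes nonneg: "\<And>k. k \<ge> 1 \<Longrightarrow> 0 \<le> v k" "\<And>k. 0 \<le> \<delta> k"
    and \<kappa>: "\<kappa> > 0" and \<theta>: "\<And>k. k \<ge> 1 \<Longrightarrow> \<theta> k \<le> 1"
    and descent: "\<And>k. k \<ge> 1 \<Longrightarrow>
      v (Suc k) + \<delta> (Suc k) + \<kappa> * (s (Suc k))\<^sup>2 \<le> v k + \<theta> k * \<delta> k"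
    and growth: "C > 0" "\<epsilon> > 0"
      "\<And>k. k \<ge> 1 \<Longrightarrow> \<bar>s k\<bar> < \<epsilon> \<Longrightarrow> v k + \<delta> k \<le> v 1 + \<delta> 1 \<Longrightarrow> v k \<le> C * (s k)\<^sup>2"
    and damp: "c > 0" "\<forall>\<^sub>F k in sequentially. \<theta> k \<le> 1 - c / real k powr r"
    and r: "0 < r" "r < 1" and q: "q \<ge> 0"
  shows "\<exists>B>0. \<forall>\<^sub>F k in sequentially. v k + \<delta> k \<le> B / real k powr q"
proof -
  \<comment> \<open>Shifted by one because \<open>descent\<close> starts at index 1;
    \<open>E 0\<close> is the initial energy.\<close>
  define E where "E k = v (Suc k) + \<delta> (Suc k)" for k
  have E_step: "E (Suc k) + \<kappa> * (s (Suc (Suc k)))\<^sup>2 \<le> E k" for k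
    using descent[of "Suc k"] mult_right_mono[OF \<theta>[of "Suc k"] nonneg(2)[of "Suc k"]]
    by (simp add: E_def)
  have "E (Suc k) \<le> E k" for k
  proof -
    have "0 \<le> \<kappa> * (s (Suc (Suc k)))\<^sup>2" using \<kappa> by simp
    then show ?thesis using E_step[of k] by linarith
  qed
  then have dec: "decseq E" by (simp add: decseq_Suc_iff)
  have E0: "0 \<le> E k" for k using nonneg by (simp add: E_def)
  obtain e where e: "E \<longlonglongrightarrow> e" using decseq_convergent[OF dec, of 0] E0 by blast
  have "(\<lambda>k. (E k - E (Suc k)) / \<kappa>) \<longlonglongrightarrow> (e - e) / \<kappa>"
    using \<kappa> by (intro tendsto_intros e LIMSEQ_Suc) auto
  then have diff: "(\<lambda>k. (E k - E (Suc k)) / \<kappa>) \<longlonglongrightarrow> 0" by simp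
  have "(s (Suc (Suc k)))\<^sup>2 \<le> (E k - E (Suc k)) / \<kappa>" for k
    using E_step[of k] \<kappa> by (simp add: field_simps)
  then have "(\<lambda>k. (s (Suc (Suc k)))\<^sup>2) \<longlonglongrightarrow> 0"
    by (intro tendsto_sandwich[OF _ _ tendsto_const diff]) auto
  then have "\<forall>\<^sub>F k in sequentially. (s (Suc (Suc k)))\<^sup>2 < \<epsilon>\<^sup>2"
    by (rule order_tendstoD) (use growth in simp)
  then have "\<forall>\<^sub>F k in sequentially. (s k)\<^sup>2 < \<epsilon>\<^sup>2"
    using eventually_sequentially_seg[of "\<lambda>k. (s k)\<^sup>2 < \<epsilon>\<^sup>2" 2] by simp
  then have v_le: "\<forall>\<^sub>F k in sequentially. v k \<le> C * (s k)\<^sup>2"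
    using eventually_ge_at_top[of 1]
  proof eventually_elim
    case (elim k)
    have "\<bar>s k\<bar> < \<epsilon>" by (rule power2_less_imp_less) (use elim(1) growth(2) in auto)
    moreover have "v k + \<delta> k \<le> v 1 + \<delta> 1"
      using decseqD[OF dec, of 0 "k - 1"] elim(2) by (simp add: E_def)
    ultimately show ?case using growth(3) elim(2) by blast
  qed
  \<comment> \<open>Chosen so that the dissipated \<open>\<kappa> * (s (Suc k))\<^sup>2\<close> pays
    for an extra \<open>b * v (Suc k)\<close>.\<close>
  define b where "b = \<kappa> / C"
  have b: "b > 0" using \<kappa> growth(1) by (simp add: b_def)
  \<comment> \<open>The sign of \<open>v 0\<close> is unknown, whereas
    \<open>superpolynomial_decay\<close> asks for nonnegativity at every index.\<close>
  define w where "w k = (if k = 0 then 0 else (1 + b) * v k + \<delta> k)" for k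
  have w0: "0 \<le> w k" for k using nonneg b by (simp add: w_def)
  \<comment> \<open>The kinetic part contracts at rate \<open>c\<close>, the value part by
    \<open>1 / (1 + b) = 1 - b / (1 + b)\<close>; the minimum serves both.\<close>
  define c' where "c' = min c (b / (1 + b))"
  have c': "c' > 0" "c' \<le> c" "c' \<le> b / (1 + b)" using damp(1) b by (auto simp: c'_def)
  have v_Suc_le: "\<forall>\<^sub>F k in sequentially. v (Suc k) \<le> C * (s (Suc k))\<^sup>2"
    using eventually_compose_filterlim[OF v_le filterlim_Suc] .
  have "\<forall>\<^sub>F k in sequentially. w (Suc k) \<le> (1 - c' / real k powr r) * w k"
    using damp(2) eventually_ge_at_top[of 1] v_Suc_le
  proof eventually_elim
    case (elim k)
    have pos: "1 \<le> real k powr r" using elim(2) r by (intro ge_one_powr_ge_zero) auto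
    have "b * v (Suc k) \<le> b * (C * (s (Suc k))\<^sup>2)"
      using elim(3) b by (intro mult_left_mono) auto
    then have "b * v (Suc k) \<le> \<kappa> * (s (Suc k))\<^sup>2"
      using growth(1) by (simp add: b_def)
    then have "w (Suc k) \<le> v k + \<theta> k * \<delta> k"
      using descent[OF elim(2)] by (simp add: w_def algebra_simps)
    also have "v k \<le> (1 - c' / real k powr r) * ((1 + b) * v k)"
    proof -
      have "c' / real k powr r \<le> c' / 1"
        using pos c' elim(2) by (intro divide_left_mono) auto
      then have "c' / real k powr r \<le> b / (1 + b)"
        using c'(3) by simp
      then have "1 / (1 + b) \<le> 1 - c' / real k powr r"
        using b by (simp add: field_simps)
      then have "1 / (1 + b) * ((1 + b) * v k) \<le> (1 - c' / real k powr r) * ((1 + b) * v k)"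
        using nonneg(1)[OF elim(2)] b by (intro mult_right_mono) auto
      then show ?thesis using b by simp
    qed
    also have "\<theta> k * \<delta> k \<le> (1 - c' / real k powr r) * \<delta> k"
    proof (rule mult_right_mono)
      have "c' / real k powr r \<le> c / real k powr r"
        using c' by (intro divide_right_mono) auto
      then show "\<theta> k \<le> 1 - c' / real k powr r" using elim(1) by linarith
    qed (rule nonneg)
    finally show ?case using elim(2) by (simp add: w_def algebra_simps)
  qed
  from superpolynomial_decay[OF w0 r(2) c'(1) q this] obtain B where
    B: "B > 0" "\<forall>\<^sub>F k in sequentially. w k \<le> B / real k powr q" by blast
  have "\<forall>\<^sub>F k in sequentially. v k + \<delta> k \<le> B / real k powr q"
    using B(2) eventually_ge_at_top[of 1]
  proof eventually_elim
    case (elim k)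
    have "0 \<le> b * v k" using nonneg(1)[OF elim(2)] b by simp
    then show ?case using elim by (simp add: w_def algebra_simps)
  qed
  with B(1) show ?thesis by blast
qed

section \<open>Forward-backward steps\<close>

locale composite_problem =
  fixes f :: "'a::{real_inner,complete_space} \<Rightarrow> real"
    and gradf :: "'a \<Rightarrow> 'a" and g :: "'a \<Rightarrow> ereal" and L :: real and xs :: 'a
  assumes f_convex: "convex_on UNIV f" and f_grad: "\<And>z. GDERIV f z :> gradf z"
    and L_pos: "L > 0" and lip: "L-lipschitz_on UNIV gradf"
    and g_proper: "proper_fun g" and g_lsc: "lsc_fun g" and g_convex: "convex_fun g"
    and xs: "xs \<in> argmin_set (objective f g)"
begin

text \<open>Both \<open>G\<close> and \<open>F\<close> are meaningful only where \<open>g\<close> is finite: \<open>real_of_ereal\<close> maps \<open>\<infinity>\<close> to 0.\<close>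
definition G :: "'a \<Rightarrow> real" where "G x = real_of_ereal (g x)"

definition F :: "'a \<Rightarrow> real" where "F x = f x + G x"

lemma g_eq_G: "g x \<noteq> \<infinity> \<Longrightarrow> g x = ereal (G x)"
  using g_proper unfolding G_def proper_fun_def by (cases "g x") auto

lemma objective_eq_F: "g x \<noteq> \<infinity> \<Longrightarrow> objective f g x = ereal (F x)"
  by (simp add: objective_def F_def g_eq_G)

lemma argmin_iff: "z \<in> argmin_set (objective f g) \<longleftrightarrow>
    is_arg_min (\<lambda>x. ereal (f x) + g x) (\<lambda>_. True) z"
  by (simp add: argmin_set_def objective_def[abs_def])

lemma argmin_finite: "z \<in> argmin_set (objective f g) \<Longrightarrow> g z \<noteq> \<infinity>"
  using is_arg_min_finite[OF g_proper, of f z] by (auto simp: argmin_iff)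

lemma F_argmin_le:
  assumes "z \<in> argmin_set (objective f g)" "g x \<noteq> \<infinity>"
  shows "F z \<le> F x"
proof -
  have "objective f g z \<le> objective f g x"
    using assms(1) by (auto simp: argmin_set_def is_arg_min_linorder)
  then show ?thesis
    using objective_eq_F[OF assms(2)] objective_eq_F[OF argmin_finite[OF assms(1)]] by simp
qed

text \<open>The affine minorant of \<open>g\<close> comes from optimality at \<open>xs\<close>:
  \<open>- gradf xs\<close> is a subgradient of \<open>g\<close> there.\<close>

lemma prox_arg_min:
  assumes "l > 0"
  shows "is_arg_min (\<lambda>x. ereal (1 / (2 * l) * (norm (x - z))\<^sup>2) + g x) (\<lambda>_. True) (prox l g z)"
proof (rule prox_is_arg_min[OF g_proper g_lsc g_convex _ assms])
  fix x
  show "ereal ((G xs + inner (gradf xs) xs) + inner (- gradf xs) x) \<le> g x"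
  proof (cases "g x = \<infinity>")
    case False
    have "G xs - inner (gradf xs) (x - xs) \<le> G x"
      unfolding G_def
      by (rule is_arg_min_subgradient[OF g_proper g_convex xs[unfolded argmin_iff]
            lipschitz_gradient_upper_bound[OF f_grad lip] False])
    then show ?thesis using g_eq_G[OF False] by (simp add: inner_diff_right)
  qed simp
qed

lemma prox_finite: "l > 0 \<Longrightarrow> g (prox l g z) \<noteq> \<infinity>"
  using is_arg_min_finite[OF g_proper prox_arg_min[of l z]] by auto

text \<open>Says that \<open>(z - prox l g z) / l\<close> is a subgradient of \<open>g\<close> at
  the proximal point. The quadratic bound required for this is the exact expansion of the
  square.\<close>

lemma prox_inequality:
  assumes l: "l > 0" and fin: "g x \<noteq> \<infinity>"
  shows "G (prox l g z) + inner (z - prox l g z) (x - prox l g z) / l \<le> G x"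
proof -
  define w where "w = prox l g z"
  have "1 / (2 * l) * (norm (x - z))\<^sup>2 \<le> 1 / (2 * l) * (norm (w - z))\<^sup>2
      + inner ((1 / l) *\<^sub>R (w - z)) (x - w) + 1 / (2 * l) * (norm (x - w))\<^sup>2" for x
    using l unfolding power2_norm_eq_inner
    by (simp add: inner_simps inner_commute field_simps)
  from is_arg_min_subgradient[OF g_proper g_convex prox_arg_min[OF l, of z, folded w_def] this fin]
  show ?thesis
    by (simp add: G_def flip: w_def) (simp add: inner_diff_left diff_divide_distrib)
qed

lemma fb_step_finite: "l > 0 \<Longrightarrow> g (fb_step gradf g l y) \<noteq> \<infinity>"
  by (simp add: fb_step_def prox_finite)

text \<open>Adds the proximal inequality at \<open>T\<close>, the tangent inequality of
  \<open>f\<close> at \<open>y\<close> and the descent lemma from \<open>y\<close> to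
  \<open>T\<close>. The gradient terms cancel, and the remaining inner product splits into three
  squares.\<close>

lemma fb_step_inequality:
  fixes x y :: 'a
  assumes l: "l > 0" and fin: "g x \<noteq> \<infinity>"
  defines "T \<equiv> fb_step gradf g l y"
  shows "F T + 1 / (2 * l) * (norm (x - T))\<^sup>2 + (1 - l * L) / (2 * l) * (norm (T - y))\<^sup>2
    \<le> F x + 1 / (2 * l) * (norm (x - y))\<^sup>2"
proof -
  have "G T + inner (y - l *\<^sub>R gradf y - T) (x - T) / l \<le> G x"
    unfolding T_def fb_step_def by (rule prox_inequality[OF l fin])
  moreover have "f y + inner (gradf y) (x - y) \<le> f x"
    by (rule convex_above_tangent[OF f_convex f_grad lip])
  moreover have "f T \<le> f y + inner (gradf y) (T - y) + L / 2 * (norm (T - y))\<^sup>2"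
    by (rule lipschitz_gradient_upper_bound[OF f_grad lip])
  moreover have "inner (y - l *\<^sub>R gradf y - T) (x - T) / l
      = inner (y - T) (x - T) / l - inner (gradf y) (x - y) + inner (gradf y) (T - y)"
    using l by (simp add: inner_simps field_simps)
  moreover have "inner (y - T) (x - T) / l = 1 / (2 * l) * (norm (x - T))\<^sup>2
      + 1 / (2 * l) * (norm (T - y))\<^sup>2 - 1 / (2 * l) * (norm (x - y))\<^sup>2"
    using l unfolding power2_norm_eq_inner
    by (simp add: inner_simps inner_commute field_simps)
  moreover have "(1 - l * L) / (2 * l) * (norm (T - y))\<^sup>2
      = 1 / (2 * l) * (norm (T - y))\<^sup>2 - L / 2 * (norm (T - y))\<^sup>2"
    using l by (simp add: field_simps)
  ultimately show ?thesis unfolding F_def by linarith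
qed

text \<open>Testing each proximal inequality at the other point and adding gives firm
  nonexpansiveness; Cauchy-Schwarz finishes.\<close>

lemma prox_nonexpansive:
  assumes l: "l > 0"
  shows "norm (prox l g z - prox l g w) \<le> norm (z - w)"
proof -
  define p q where "p = prox l g z" and "q = prox l g w"
  have "G p + inner (z - p) (q - p) / l \<le> G q"
    unfolding p_def q_def by (intro prox_inequality prox_finite l)
  moreover have "G q + inner (w - q) (p - q) / l \<le> G p"
    unfolding p_def q_def by (intro prox_inequality prox_finite l)
  ultimately have "inner (z - p) (q - p) / l + inner (w - q) (p - q) / l \<le> 0"
    by linarith
  then have "inner (z - p) (q - p) + inner (w - q) (p - q) \<le> 0"
    using l by (simp add: field_simps)
  then have "(norm (p - q))\<^sup>2 \<le> inner (z - w) (p - q)"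
    unfolding power2_norm_eq_inner by (simp add: inner_simps inner_commute)
  also have "\<dots> \<le> norm (z - w) * norm (p - q)" by (rule norm_cauchy_schwarz)
  finally have "norm (p - q) * norm (p - q) \<le> norm (z - w) * norm (p - q)"
    by (simp add: power2_eq_square)
  then have "norm (p - q) \<le> norm (z - w)"
    by (cases "p = q") auto
  then show ?thesis by (simp add: p_def q_def)
qed

lemma fb_step_lipschitz:
  assumes l: "l > 0"
  shows "norm (fb_step gradf g l y - fb_step gradf g l z) \<le> (1 + l * L) * norm (y - z)"
proof -
  have "norm (fb_step gradf g l y - fb_step gradf g l z)
      \<le> norm ((y - l *\<^sub>R gradf y) - (z - l *\<^sub>R gradf z))"
    unfolding fb_step_def by (rule prox_nonexpansive[OF l])
  also have "\<dots> = norm ((y - z) - l *\<^sub>R (gradf y - gradf z))"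
    by (simp add: algebra_simps)
  also have "\<dots> \<le> norm (y - z) + l * norm (gradf y - gradf z)"
    using l norm_triangle_ineq4[of "y - z" "l *\<^sub>R (gradf y - gradf z)"] by simp
  also have "\<dots> \<le> norm (y - z) + l * (L * norm (y - z))"
    using lipschitz_onD[OF lip, of y z] l by (simp add: dist_norm)
  finally show ?thesis by (simp add: algebra_simps)
qed

text \<open>Transfers residuals from the step size of the algorithm to the size \<open>1 / L\<close>
  of the error bound. The two proximal inequalities give
  \<open>(norm B / m - norm A / l) * (norm B - norm A) \<le> 0\<close>, while the negated claim
  makes both factors positive.\<close>

lemma fb_residual_le:
  assumes l: "0 < l" "l \<le> m"
  shows "norm (fb_step gradf g m x - x) \<le> m / l * norm (fb_step gradf g l x - x)"
proof (rule ccontr)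
  define p q where "p = fb_step gradf g l x" and "q = fb_step gradf g m x"
  define A B where "A = x - p" and "B = x - q"
  have m: "m > 0" using l by linarith
  assume "\<not> ?thesis"
  then have big: "m / l * norm A < norm B"
    by (simp add: A_def B_def p_def q_def norm_minus_commute)
  have "1 * norm A \<le> m / l * norm A"
    using l by (intro mult_right_mono) auto
  then have big': "norm A < norm B" using big by simp
  have "G p + inner (x - l *\<^sub>R gradf x - p) (q - p) / l \<le> G q"
    unfolding p_def q_def fb_step_def by (intro prox_inequality prox_finite l m)
  moreover have "G q + inner (x - m *\<^sub>R gradf x - q) (p - q) / m \<le> G p"
    unfolding p_def q_def fb_step_def by (intro prox_inequality prox_finite l m)
  moreover have "inner (x - l *\<^sub>R gradf x - p) (q - p) / l
      = inner A (A - B) / l - inner (gradf x) (q - p)"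
    using l by (simp add: A_def B_def inner_simps field_simps)
  moreover have "inner (x - m *\<^sub>R gradf x - q) (p - q) / m
      = inner B (B - A) / m + inner (gradf x) (q - p)"
    using m by (simp add: A_def B_def inner_simps field_simps)
  ultimately have "inner A (A - B) / l + inner B (B - A) / m \<le> 0" by linarith
  then have "(norm A)\<^sup>2 / l + (norm B)\<^sup>2 / m \<le> (1 / l + 1 / m) * inner A B"
    unfolding power2_norm_eq_inner
    by (simp add: inner_diff_right inner_commute diff_divide_distrib ring_distribs)
  also have "\<dots> \<le> (1 / l + 1 / m) * (norm A * norm B)"
    using l m by (intro mult_left_mono norm_cauchy_schwarz) auto
  finally have "(norm B / m - norm A / l) * (norm B - norm A) \<le> 0"
    by (simp add: power2_eq_square algebra_simps add_divide_distrib)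
  moreover have "norm A / l < norm B / m" using big l m by (simp add: field_simps)
  then have "0 < (norm B / m - norm A / l) * (norm B - norm A)"
    using big' by (intro mult_pos_pos) auto
  ultimately show False by linarith
qed

text \<open>As \<open>x\<close> is the step from \<open>y\<close>, its residual is a difference of
  two steps, of order \<open>norm (x - y)\<close>. The error bound then puts \<open>y\<close> close
  to the solution set, and \<open>fb_step_inequality\<close> against nearby solutions turns this
  distance into a bound on the value gap.\<close>

lemma error_bound_growth:
  assumes leb: "local_error_bound f gradf g L" and l: "0 < l" "l * L \<le> 1"
    and \<xi>: "F xs \<le> \<xi>"
  shows "\<exists>C>0. \<exists>\<epsilon>>0. \<forall>x y. x = fb_step gradf g l y \<longrightarrow> norm (x - y) < \<epsilon> \<longrightarrow> F x \<le> \<xi> \<longrightarrow>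
    F x - F xs \<le> C * (norm (x - y))\<^sup>2"
proof -
  let ?X = "argmin_set (objective f g)"
  have "(INF x. objective f g x) \<le> objective f g xs" by (rule INF_lower) simp
  also have "\<dots> \<le> ereal \<xi>" using \<xi> objective_eq_F[OF argmin_finite[OF xs]] by simp
  finally obtain \<epsilon> \<tau> where \<epsilon>: "\<epsilon> > 0" and \<tau>: "\<tau> > 0" and eb: "\<And>x.
      norm (fb_step gradf g (1 / L) x - x) < \<epsilon> \<Longrightarrow> objective f g x \<le> ereal \<xi> \<Longrightarrow>
      infdist x ?X \<le> \<tau> * norm (fb_step gradf g (1 / L) x - x)"
    using leb unfolding local_error_bound_def by meson
  \<comment> \<open>The ratio of the step sizes \<open>1 / L\<close> and \<open>l\<close>, times the
    Lipschitz constant of the step.\<close>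
  define K where "K = 1 / (L * l) * (1 + l * L)"
  have lL: "l * L > 0" using l L_pos by simp
  have K: "K > 0" unfolding K_def using l L_pos by (intro mult_pos_pos add_pos_pos) auto
  define C where "C = (\<tau> * K + 1)\<^sup>2 / (2 * l)"
  have "F x - F xs \<le> C * (norm (x - y))\<^sup>2"
    if x: "x = fb_step gradf g l y" and small: "norm (x - y) < \<epsilon> / K" and F: "F x \<le> \<xi>" for x y
  proof -
    have gx: "g x \<noteq> \<infinity>" using x l by (simp add: fb_step_finite)
    have "norm (fb_step gradf g (1 / L) x - x) \<le> 1 / L / l * norm (fb_step gradf g l x - x)"
      using l L_pos by (intro fb_residual_le) (auto simp: field_simps)
    also have "\<dots> \<le> 1 / L / l * ((1 + l * L) * norm (x - y))"
      using fb_step_lipschitz[OF l(1), of x y] l L_pos by (intro mult_left_mono) (auto simp flip: x)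
    finally have R: "norm (fb_step gradf g (1 / L) x - x) \<le> K * norm (x - y)"
      by (simp add: K_def)
    have "K * norm (x - y) < \<epsilon>" using small K by (simp add: field_simps)
    then have "infdist x ?X \<le> \<tau> * norm (fb_step gradf g (1 / L) x - x)"
      using R F objective_eq_F[OF gx] by (intro eb) auto
    also have "\<dots> \<le> \<tau> * (K * norm (x - y))" using R \<tau> by simp
    finally have near: "infdist y ?X \<le> (\<tau> * K + 1) * norm (x - y)"
      using infdist_triangle[of y ?X x] by (simp add: dist_norm norm_minus_commute algebra_simps)
    have D: "0 \<le> F x - F xs" using F_argmin_le[OF xs gx] by simp
    \<comment> \<open>In square-root form the bound passes to the infimum over \<open>z\<close>,
      without choosing a nearest solution.\<close>
    have "sqrt (2 * l * (F x - F xs)) \<le> dist y z" if z: "z \<in> ?X" for z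
    proof -
      have "F x + 1 / (2 * l) * (norm (z - x))\<^sup>2 + (1 - l * L) / (2 * l) * (norm (x - y))\<^sup>2
          \<le> F z + 1 / (2 * l) * (norm (z - y))\<^sup>2"
        unfolding x by (rule fb_step_inequality[OF l(1) argmin_finite[OF z]])
      moreover have "0 \<le> 1 / (2 * l) * (norm (z - x))\<^sup>2" using l by simp
      moreover have "0 \<le> (1 - l * L) / (2 * l) * (norm (x - y))\<^sup>2" using l by simp
      moreover have "F z \<le> F xs" using F_argmin_le[OF z argmin_finite[OF xs]] .
      ultimately have "F x - F xs \<le> 1 / (2 * l) * (norm (z - y))\<^sup>2" by linarith
      then have "2 * l * (F x - F xs) \<le> (dist y z)\<^sup>2"
        using l by (simp add: field_simps dist_norm norm_minus_commute)
      then show ?thesis by (intro real_le_lsqrt) auto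
    qed
    then have "sqrt (2 * l * (F x - F xs)) \<le> infdist y ?X"
      using xs by (auto simp: infdist_def intro!: cINF_greatest)
    also note near
    finally have "2 * l * (F x - F xs) \<le> ((\<tau> * K + 1) * norm (x - y))\<^sup>2"
      using D l by (simp add: sqrt_le_D)
    then have "F x - F xs \<le> ((\<tau> * K + 1) * norm (x - y))\<^sup>2 / (2 * l)"
      using l by (simp add: pos_le_divide_eq mult_ac)
    then show ?thesis by (simp add: C_def power_mult_distrib)
  qed
  moreover have "C > 0" unfolding C_def using \<tau> K l by (intro divide_pos_pos zero_less_power add_pos_pos mult_pos_pos) auto
  moreover have "\<epsilon> / K > 0" using \<epsilon> K by simp
  ultimately show ?thesis by blast
qed

text \<open>Continuity of \<open>f\<close> turns convergence of the values into convergent upper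
  bounds on \<open>g (x k)\<close>, to which lower semicontinuity applies.\<close>

lemma limit_in_argmin:
  assumes lim: "x \<longlonglongrightarrow> z" and F: "(\<lambda>k. F (x k)) \<longlonglongrightarrow> F xs"
    and fin: "\<forall>\<^sub>F k in sequentially. g (x k) \<noteq> \<infinity>"
  shows "z \<in> argmin_set (objective f g)"
proof -
  have "isCont f z" using f_grad[of z] unfolding gderiv_def by (rule has_derivative_continuous)
  then have "(\<lambda>k. F (x k) - f (x k)) \<longlonglongrightarrow> F xs - f z"
    by (intro tendsto_intros F isCont_tendsto_compose[OF _ lim])
  moreover have "\<forall>\<^sub>F k in sequentially. g (x k) \<le> ereal (F (x k) - f (x k))"
    using fin by eventually_elim (simp add: g_eq_G F_def)
  ultimately have "g z \<le> ereal (F xs - f z)" by (rule lsc_fun_tendsto_le[OF g_lsc lim])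
  then have "objective f g z \<le> ereal (f z) + ereal (F xs - f z)"
    unfolding objective_def by (intro add_left_mono)
  also have "\<dots> = objective f g xs" using objective_eq_F[OF argmin_finite[OF xs]] by simp
  finally show ?thesis
    using xs unfolding argmin_set_def is_arg_min_linorder by (auto intro: order_trans)
qed

end

section \<open>The inertial iteration\<close>

text \<open>With \<open>u\<close> and \<open>w\<close> the powers at \<open>k\<close> and
  \<open>k + 1\<close>, \<open>1 - \<gamma> = (w - u + a) / (w - 1 + a)\<close>. The numerator is at
  least \<open>a\<close>, and \<open>w \<le> 2 * u\<close> bounds the denominator by
  \<open>(2 + a) * u\<close>.\<close>

lemma inertia_bounds:
  fixes r a :: real and k :: nat
  assumes r: "0 < r" "r < 1" and a: "a > 0" and k: "k \<ge> 1"
  defines "\<gamma> \<equiv> ((real k powr r - 1 + a) / a - 1) / ((real (k + 1) powr r - 1 + a) / a)"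
  shows "0 \<le> \<gamma>" and "\<gamma> \<le> 1 - a / (2 + a) / real k powr r"
proof -
  define u w where "u = real k powr r" and "w = real (k + 1) powr r"
  have u: "1 \<le> u" unfolding u_def using k r by (intro ge_one_powr_ge_zero) auto
  have uw: "u \<le> w" unfolding u_def w_def using k r by (intro powr_mono2) auto
  have "w \<le> (2 * real k) powr r" unfolding w_def using k r by (intro powr_mono2) auto
  also have "\<dots> = 2 powr r * u" unfolding u_def by (simp add: powr_mult)
  also have "\<dots> \<le> 2 * u"
    using r u powr_mono[of r 1 2] by (intro mult_right_mono) auto
  finally have w: "w \<le> 2 * u" .
  have "(u - 1 + a) / a - 1 = (u - 1) / a" using a by (simp add: field_simps)
  then have \<gamma>: "\<gamma> = (u - 1) / (w - 1 + a)"
    unfolding \<gamma>_def u_def[symmetric] w_def[symmetric] using a by simp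
  have pos: "w - 1 + a > 0" using u uw a by linarith
  show "0 \<le> \<gamma>" using u pos by (simp add: \<gamma>)
  have "a \<le> a * u" using a u by simp
  then have "w - 1 + a \<le> (2 + a) * u" using w by (simp add: distrib_right)
  then have "a / ((2 + a) * u) \<le> a / (w - 1 + a)"
    using a pos u by (intro divide_left_mono mult_pos_pos) auto
  also have "\<dots> \<le> (w - u + a) / (w - 1 + a)"
    using uw pos by (intro divide_right_mono) auto
  also have "\<dots> = 1 - \<gamma>"
    using pos by (simp add: \<gamma> field_simps)
  finally show "\<gamma> \<le> 1 - a / (2 + a) / real k powr r"
    by (simp add: u_def)
qed

text \<open>The eventual finiteness clause gives the little-o claim its meaning, since
  \<open>real_of_ereal\<close> sends infinite values to 0.\<close>

theorem corollary3p3: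
  fixes f :: "'a::{real_inner,complete_space} \<Rightarrow> real"
    and gradf :: "'a \<Rightarrow> 'a"
    and g :: "'a \<Rightarrow> ereal"
    and x y :: "nat \<Rightarrow> 'a"
    and xs :: 'a
    and L \<mu> r a p :: real
  assumes "convex_on UNIV f"
    and "\<forall>z. GDERIV f z :> gradf z"
    and "continuous_on UNIV gradf"
    and "L > 0" and "L-lipschitz_on UNIV gradf"
    and "proper_fun g" and "lsc_fun g" and "convex_fun g"
    and "xs \<in> argmin_set (objective f g)"
    and "0 < \<mu>" and "\<mu> < 1"
    and "0 < r" and "r < 1" and "a > 0"
    and "local_error_bound f gradf g L"
    and "ifb_sequence gradf g (\<mu> / L) (\<lambda>k. (real k powr r - 1 + a) / a) x y"
    and "p > 1"
  shows "((\<forall>\<^sub>F k in sequentially. \<bar>objective f g (x k) - objective f g xs\<bar> \<noteq> \<infinity>) \<and>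
          (\<lambda>k. real_of_ereal (objective f g (x k) - objective f g xs)) \<in> o(\<lambda>k. 1 / real k powr p) \<and>
          (\<lambda>k. norm (x k - x (k - 1))) \<in> O(\<lambda>k. 1 / real k powr p)) \<and>
         (\<exists>xbar \<in> argmin_set (objective f g).
            x \<longlonglongrightarrow> xbar \<and>
            (\<lambda>k. norm (x k - xbar)) \<in> O(\<lambda>k. 1 / real k powr (p - 1)))"
proof -
  interpret composite_problem f gradf g L xs
    using assms by unfold_locales auto
  define l where "l = \<mu> / L"
  have l: "l > 0" "l * L = \<mu>" using assms(4,10) by (simp_all add: l_def)
  define \<gamma> where "\<gamma> k = ((real k powr r - 1 + a) / a - 1) / ((real (k + 1) powr r - 1 + a) / a)"
    for k
  have x_step: "x k = fb_step gradf g l (y k)" if "k \<ge> 1" for k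
    using assms(16) that unfolding ifb_sequence_def l_def by blast
  have y_step: "y (Suc k) = x k + \<gamma> k *\<^sub>R (x k - x (k - 1))" if "k \<ge> 1" for k
    using assms(16) that unfolding ifb_sequence_def \<gamma>_def by simp
  have \<gamma>: "0 \<le> \<gamma> k" "\<gamma> k \<le> 1 - a / (2 + a) / real k powr r" if "k \<ge> 1" for k
    using inertia_bounds[OF assms(12-14) that] unfolding \<gamma>_def by auto
  have \<gamma>2: "(\<gamma> k)\<^sup>2 \<le> \<gamma> k" "(\<gamma> k)\<^sup>2 \<le> 1" if "k \<ge> 1" for k
  proof -
    have "0 \<le> a / (2 + a) / real k powr r" using assms(14) by simp
    then have "\<gamma> k \<le> 1" using \<gamma>[OF that] by linarith
    then show "(\<gamma> k)\<^sup>2 \<le> \<gamma> k" using \<gamma>(1)[OF that]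
      by (simp add: power2_eq_square mult_left_le)
    then show "(\<gamma> k)\<^sup>2 \<le> 1" using \<open>\<gamma> k \<le> 1\<close> by linarith
  qed
  \<comment> \<open>Starts at index 1: the initial point \<open>x 0\<close> is arbitrary and
    \<open>g\<close> may be infinite there.\<close>
  have fin: "g (x k) \<noteq> \<infinity>" if "k \<ge> 1" for k
    using x_step[OF that] fb_step_finite[OF l(1)] by simp
  define v where "v k = F (x k) - F xs" for k
  define \<delta> where "\<delta> k = 1 / (2 * l) * (norm (x k - x (k - 1)))\<^sup>2" for k
  define s where "s k = norm (x k - y k)" for k
  have v0: "0 \<le> v k" if "k \<ge> 1" for k
    using F_argmin_le[OF xs fin[OF that]] by (simp add: v_def)
  have \<delta>0: "0 \<le> \<delta> k" for k using l by (simp add: \<delta>_def)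
  have descent: "v (Suc k) + \<delta> (Suc k) + (1 - \<mu>) / (2 * l) * (s (Suc k))\<^sup>2
      \<le> v k + (\<gamma> k)\<^sup>2 * \<delta> k" if "k \<ge> 1" for k
  proof -
    have "norm (x k - y (Suc k)) = \<gamma> k * norm (x k - x (k - 1))"
      using y_step[OF that] \<gamma>(1)[OF that] by simp
    then have "1 / (2 * l) * (norm (x k - y (Suc k)))\<^sup>2 = (\<gamma> k)\<^sup>2 * \<delta> k"
      by (simp add: \<delta>_def power_mult_distrib)
    moreover have "F (x (Suc k)) + 1 / (2 * l) * (norm (x k - x (Suc k)))\<^sup>2
        + (1 - \<mu>) / (2 * l) * (norm (x (Suc k) - y (Suc k)))\<^sup>2
        \<le> F (x k) + 1 / (2 * l) * (norm (x k - y (Suc k)))\<^sup>2"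
      using fb_step_inequality[OF l(1) fin[OF that], of "y (Suc k)"]
      by (simp only: x_step[of "Suc k"] l(2))
    moreover have "\<delta> (Suc k) = 1 / (2 * l) * (norm (x k - x (Suc k)))\<^sup>2"
      by (simp add: \<delta>_def norm_minus_commute)
    ultimately show ?thesis unfolding v_def s_def by linarith
  qed
  \<comment> \<open>The error bound is used at the level of the initial energy, below which the
    values of all iterates from index 1 on stay.\<close>
  have "F xs \<le> F xs + v 1 + \<delta> 1" using v0[of 1] \<delta>0[of 1] by simp
  from error_bound_growth[OF assms(15) l(1) _ this] assms(11) l(2)
  obtain C \<epsilon> where C: "C > 0" "\<epsilon> > 0" "\<And>x y. x = fb_step gradf g l y \<Longrightarrow> norm (x - y) < \<epsilon> \<Longrightarrow>
      F x \<le> F xs + v 1 + \<delta> 1 \<Longrightarrow> F x - F xs \<le> C * (norm (x - y))\<^sup>2" by auto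
  \<comment> \<open>The kinetic term is a squared norm, so \<open>2 * (p + 1)\<close> gives steps of
    order \<open>p + 1 = (p - 1) + 2\<close>, the exponent that
    \<open>convergent_rate_of_steps\<close> needs for the rate \<open>p - 1\<close>.\<close>
  have "\<exists>B>0. \<forall>\<^sub>F k in sequentially. v k + \<delta> k \<le> B / real k powr (2 * (p + 1))"
  proof (rule inertial_energy_decay[where s = s and \<theta> = "\<lambda>k. (\<gamma> k)\<^sup>2"
        and \<kappa> = "(1 - \<mu>) / (2 * l)" and c = "a / (2 + a)"])
    show "v k \<le> C * (s k)\<^sup>2" if "k \<ge> 1" "\<bar>s k\<bar> < \<epsilon>" "v k + \<delta> k \<le> v 1 + \<delta> 1" for k
      using C(3)[OF x_step[OF that(1)]] that \<delta>0[of k] by (simp add: v_def s_def)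
    show "\<forall>\<^sub>F k in sequentially. (\<gamma> k)\<^sup>2 \<le> 1 - a / (2 + a) / real k powr r"
      using eventually_ge_at_top[of 1] by eventually_elim (use \<gamma> \<gamma>2 in \<open>blast intro: order_trans\<close>)
  qed (use v0 \<delta>0 \<gamma>2 descent C(1,2) l assms in auto)
  then obtain B where B: "B > 0"
    "\<forall>\<^sub>F k in sequentially. v k + \<delta> k \<le> B / real k powr (2 * (p + 1))" by blast
  have "\<forall>\<^sub>F k in sequentially. norm (v k) \<le> B * norm (1 / real k powr (2 * (p + 1)))"
    using B(2) eventually_ge_at_top[of 1]
  proof eventually_elim
    case (elim k)
    then show ?case using v0[of k] \<delta>0[of k] by simp
  qed
  then have "v \<in> O(\<lambda>k. 1 / real k powr (2 * (p + 1)))" by (rule bigoI)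
  also have "(\<lambda>k. 1 / real k powr (2 * (p + 1))) \<in> o(\<lambda>k. 1 / real k powr p)"
    using assms(17) by real_asymp
  finally have v_small: "v \<in> o(\<lambda>k. 1 / real k powr p)" .
  have obj: "objective f g (x k) - objective f g xs = ereal (v k)" if "k \<ge> 1" for k
    using objective_eq_F[OF fin[OF that]] objective_eq_F[OF argmin_finite[OF xs]]
    by (simp add: v_def)
  have ev_obj: "\<forall>\<^sub>F k in sequentially. objective f g (x k) - objective f g xs = ereal (v k)"
    using eventually_ge_at_top[of 1] by (rule eventually_mono) (rule obj)
  define D where "D = sqrt (2 * l * B)"
  have D: "D \<ge> 0" using l B by (simp add: D_def)
  have steps: "\<forall>\<^sub>F k in sequentially. norm (x k - x (k - 1)) \<le> D / real k powr (p + 1)"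
    using B(2) eventually_ge_at_top[of 1]
  proof eventually_elim
    case (elim k)
    have "\<delta> k \<le> B / real k powr (2 * (p + 1))" using elim v0[of k] by simp
    then have "(norm (x k - x (k - 1)))\<^sup>2 \<le> 2 * l * (B / real k powr (2 * (p + 1)))"
      using l by (simp add: \<delta>_def field_simps)
    also have "real k powr (2 * (p + 1)) = (real k powr (p + 1))\<^sup>2"
      by (simp add: power2_eq_square flip: powr_add)
    also have "2 * l * (B / (real k powr (p + 1))\<^sup>2) = (D / real k powr (p + 1))\<^sup>2"
      using l B by (simp add: D_def power_divide)
    finally show ?case by (rule power2_le_imp_le) (use D in simp)
  qed
  have "(\<lambda>k. norm (x k - x (k - 1))) \<in> O(\<lambda>k. 1 / real k powr (p + 1))"
    using steps by (intro bigoI[of _ D]) (auto elim: eventually_mono)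
  also have "(\<lambda>k. 1 / real k powr (p + 1)) \<in> O(\<lambda>k. 1 / real k powr p)"
    using assms(17) by real_asymp
  finally have steps_O: "(\<lambda>k. norm (x k - x (k - 1))) \<in> O(\<lambda>k. 1 / real k powr p)" .
  have "\<forall>\<^sub>F k in sequentially. norm (x (Suc k) - x k) \<le> D / real (Suc k) powr ((p - 1) + 2)"
    using eventually_compose_filterlim[OF steps filterlim_Suc] by (simp add: add.commute)
  from convergent_rate_of_steps[OF _ D this] assms(17) obtain xbar where
    xbar: "x \<longlonglongrightarrow> xbar" "(\<lambda>k. norm (x k - xbar)) \<in> O(\<lambda>k. 1 / real k powr (p - 1))" by auto
  have "(\<lambda>k. 1 / real k powr p) \<in> O(\<lambda>k. 1 :: real)" using assms(17) by real_asymp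
  with v_small have "v \<in> o(\<lambda>k. 1)" by (rule landau_o.small_big_trans)
  then have "v \<longlonglongrightarrow> 0" by (rule smalloD_tendsto[of _ _ "\<lambda>_. 1", simplified])
  then have "(\<lambda>k. F (x k)) \<longlonglongrightarrow> F xs" unfolding v_def by (simp add: LIM_zero_iff)
  moreover have "\<forall>\<^sub>F k in sequentially. g (x k) \<noteq> \<infinity>"
    using eventually_ge_at_top[of 1] by (rule eventually_mono) (rule fin)
  ultimately have "xbar \<in> argmin_set (objective f g)"
    by (rule limit_in_argmin[OF xbar(1)])
  moreover have "(\<lambda>k. real_of_ereal (objective f g (x k) - objective f g xs))
      \<in> o(\<lambda>k. 1 / real k powr p)"
    using v_small ev_obj by (subst landau_o.small.in_cong) (auto elim: eventually_mono)
  moreover have "\<forall>\<^sub>F k in sequentially. \<bar>objective f g (x k) - objective f g xs\<bar> \<noteq> \<infinity>"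
    using ev_obj by eventually_elim simp
  ultimately show ?thesis using steps_O xbar by blast
qed

end
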